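(* Suppose that the semicontinuous-model assumption (conditions (A1)–(A5) of the context) and the control-affine assumption (C) of the context hold, and that $v_t^\star$ is locally Lipschitz continuous on $\mathcal{Z}_t$ for each $t$. Then, for all $t=0,\ldots,K$, $$0\le v_t^{\hat\pi}(x)-v_t^\star(x)\le v_t^{\hat\pi}(x)-\hat v_t(x)+\sum_{k=t+1}^K L_k\,\delta\qquad\text{for all }x\in\mathcal{Z}_t,$$ where $L_k:=\sup_{j=1,\ldots,N_{\mathcal{C},k}}\ \sup_{x,x'\in\mathcal{C}_j,\ x\ne x'}\frac{|v_k^\star(x)-v_k^\star(x')|}{\|x-x'\|}$.
   Context: Control problem. Let $K\ge 1$ be an integer, $\mathcal{X}\subseteq\mathbb{R}^n$, $\mathcal{U}\subseteq\mathbb{R}^m$, $\Xi\subseteq\mathbb{R}^l$ Borel sets, and for each $x\in\mathcal{X}$ let $\mathcal{U}(x)\subseteq\mathcal{U}$ be a nonempty Borel set of admissible actions; put $\mathcal{K}:=\{(x,u): x\in\mathcal{X},\,u\in\mathcal{U}(x)\}$. Let $f:\mathcal{X}\times\mathcal{U}\times\Xi\to\mathcal{X}$, $r:\mathcal{X}\times\mathcal{U}\to\mathbb{R}$ (stage cost) and $q:\mathcal{X}\to\mathbb{R}$ (terminal cost) be measurable. The system is $x_{t+1}=f(x_t,u_t,\xi_t)$ with i.i.d. disturbances $\xi_t$ distributed as $\xi$ with values in $\Xi$. Semicontinuous-model assumption: (A1) $\mathcal{U}(x)$ is compact for each $x\in\mathcal{X}$ and the multifunction $x\mapsto\mathcal{U}(x)$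 is upper semicontinuous. (A2) $r$ and $q$ are lower semicontinuous on $\mathcal{K}$ and $\mathcal{X}$, respectively. (A3) There exist nonnegative constants $\bar r,\bar q,\beta$ with $\beta\ge1$ and a continuous function $w:\mathcal{X}\to[1,\infty)$ such that $|r(x,u)|\le\bar r w(x)$, $|q(x)|\le\bar q w(x)$ and $\mathbb{E}[w(f(x,u,\xi))]\le\beta w(x)$ for all $(x,u)\in\mathcal{K}$. (A4) $(x,u)\mapsto f(x,u,\boldsymbol{\xi})$ is continuous on $\mathcal{K}$ for each $\boldsymbol{\xi}\in\Xi$. (A5) $\Xi=\{\hat\xi^{[1]},\ldots,\hat\xi^{[N]}\}$ is finite. Write $p_s:=\mathrm{Prob}(\xi=\hat\xi^{[s]})$, $\sum_{s=1}^N p_s=1$, and $\mathcal{S}:=\{1,\ldots,N\}$. Control-affine assumption (C): $f(x,u,\boldsymbol{\xi})=g(x,\boldsymbol{\xi})+h(x,\boldsymbol{\xi})u$, where $g:\mathcal{X}\times\Xi\to\mathbb{R}^n$ and $h:\mathcal{X}\times\Xi\to\mathbb{R}^{n\times m}$ are (possibly nonlinear) measurable functions such that $g(\cdot,\boldsymbol{\xi})$ and $h(\cdot,\boldsymbol{\xi})$ are continuous for each $\boldsymbol{\xi}\in\Xi$; and $u\mapsto r(x,u)$ is convex on $\mathcal{U}(x)$ for each $x\in\mathcal{X}$. Discretization. $\mathcal{Z}_0\subseteq\mathcal{Z}_1\subseteq\cdots\subseteq\mathcal{Z}_K\subseteq\mathcal{X}$ are convex compact sets with $\{f(x,u,\boldsymbol{\xi}):x\in\mathcal{Z}_t,u\in\mathcal{U}(x),\boldsymbol{\xi}\in\Xi\}\subseteq\mathcal{Z}_{t+1}$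 for $t=0,\ldots,K-1$. $\mathcal{C}_1,\ldots,\mathcal{C}_{N_{\mathcal{C}}}$ are convex compact subsets (cells) of $\mathcal{Z}_K$ with pairwise disjoint interiors, and there are $N_{\mathcal{C},0}\le\cdots\le N_{\mathcal{C},K}=N_{\mathcal{C}}$ with $\bigcup_{i=1}^{N_{\mathcal{C},t}}\mathcal{C}_i=\mathcal{Z}_t$ for every $t$. Nodes $x^{[1]},\ldots,x^{[M_K]}\in\mathcal{Z}_K$ are chosen so that each $\mathcal{C}_i$ is the convex hull of a subset of the nodes, and $M_0\le\cdots\le M_K$ are such that $x^{[1]},\ldots,x^{[M_t]}$ are exactly the nodes lying in $\mathcal{Z}_t$. Set $\delta:=\max_{k}\max_{x^{[i]},x^{[j]}\in\mathcal{C}_k}\|x^{[i]}-x^{[j]}\|$. Optimal value function. $v_K^{opt}:=q$ and $v_t^{opt}(x):=\inf_{u\in\mathcal{U}(x)}\{r(x,u)+\sum_{s=1}^N p_s v_{t+1}^{opt}(f(x,u,\hat\xi^{[s]}))\}$ for $x\in\mathcal{X}$, $t=K-1,\ldots,0$ (this is the minimal expected cost-to-go $\inf_\pi\mathbb{E}^\pi[\sum_{k=t}^{K-1}r(x_k,u_k)+q(x_K)\mid x_t=x]$); $v_t^\star$ is the restriction of $v_t^{opt}$ to $\mathcal{Z}_t$. Approximate operator. For bounded measurable $v:\mathcal{Z}_{t+1}\to\mathbb{R}$ and $x\in\mathcal{Z}_t$, $$(\hat T_t v)(x):=\inf_{u,\gamma}\Big\{r(x,u)+\sum_{s=1}^N\sum_{i=1}^{M_{t+1}}p_s\gamma_{s,i}v(x^{[i]})\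 :\ f(x,u,\hat\xi^{[s]})=\sum_{i=1}^{M_{t+1}}\gamma_{s,i}x^{[i]},\ \gamma_s\in\Delta\ \forall s\in\mathcal{S},\ u\in\mathcal{U}(x)\Big\},$$ where $\Delta:=\{\gamma\in\mathbb{R}^{M_{t+1}}:\sum_i\gamma_i=1,\ \gamma_i\ge0\}$. Define $\hat v_K:=q$ on $\mathcal{Z}_K$ and $\hat v_t:=\hat T_t\hat v_{t+1}$ on $\mathcal{Z}_t$ for $t=K-1,\ldots,0$. Approximate policy. $\hat\pi=(\hat\pi_0,\ldots,\hat\pi_{K-1})$, where for each $x\in\mathcal{Z}_t$, $\hat\pi_t(x)\in\mathcal{U}(x)$ is the $u$-component of an optimal solution $(u,\gamma)$ of the minimization problem defining $(\hat T_t\hat v_{t+1})(x)$. Its cost-to-go is $v_K^{\hat\pi}:=q$ on $\mathcal{Z}_K$ and $v_t^{\hat\pi}(x):=r(x,\hat\pi_t(x))+\sum_{s=1}^N p_s v_{t+1}^{\hat\pi}(f(x,\hat\pi_t(x),\hat\xi^{[s]}))$ for $x\in\mathcal{Z}_t$. Conventions: a supremum over the empty set is $0$, an empty sum is $0$. *)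

theory Defs
  imports "HOL-Analysis.Analysis" "HOL-Probability.Probability"
begin

section \<open>Semicontinuity and local Lipschitz continuity\<close>

definition lsc_on :: "'a::topological_space set \<Rightarrow> ('a \<Rightarrow> real) \<Rightarrow> bool" where
  "lsc_on S f \<longleftrightarrow> (\<forall>z\<in>S. \<forall>a. a < f z \<longrightarrow> (\<forall>\<^sub>F y in at z within S. a < f y))"

definition usc_multifunction_on ::
    "'a::topological_space set \<Rightarrow> ('a \<Rightarrow> 'b::topological_space set) \<Rightarrow> bool" where
  "usc_multifunction_on S F \<longleftrightarrow>
     (\<forall>V. open V \<longrightarrow> openin (top_of_set S) {x \<in> S. F x \<subseteq> V})"

definition locally_lipschitz_on :: "'a::metric_space set \<Rightarrow> ('a \<Rightarrow> 'b::metric_space) \<Rightarrow> bool" where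
  "locally_lipschitz_on S f \<longleftrightarrow> (\<forall>x\<in>S. \<exists>e>0. \<exists>L. L-lipschitz_on (cball x e \<inter> S) f)"

text \<open>The library predicate \<^const>\<open>convex_on\<close> also demands that the set itself be convex, which is not
  assumed of the sets of admissible actions; only the inequality inside the set is required here.\<close>

definition convex_fun_within :: "'a::real_vector set \<Rightarrow> ('a \<Rightarrow> real) \<Rightarrow> bool" where
  "convex_fun_within S f \<longleftrightarrow>
     (\<forall>x\<in>S. \<forall>y\<in>S. \<forall>a\<ge>0. \<forall>b\<ge>0. a + b = 1 \<longrightarrow> a *\<^sub>R x + b *\<^sub>R y \<in> S \<longrightarrow>
        f (a *\<^sub>R x + b *\<^sub>R y) \<le> a * f x + b * f y)"


section \<open>The control problem\<close>

definition admissible_pairs :: "'x set \<Rightarrow> ('x \<Rightarrow> 'u set) \<Rightarrow> ('x \<times> 'u) set" where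
  "admissible_pairs X Ua = {(x, u). x \<in> X \<and> u \<in> Ua x}"

text \<open>\<open>Ua x\<close> is the set of admissible actions in state \<open>x\<close>; \<open>\<xi>seq t\<close> is the disturbance at time \<open>t\<close>,
  a copy of the generic disturbance \<open>\<xi>\<close>.\<close>

locale control_problem = prob_space P
  for P :: "'w measure" +
  fixes K :: nat
    and X :: "(real ^ 'n) set"
    and U :: "(real ^ 'm) set"
    and \<Xi> :: "(real ^ 'l) set"
    and Ua :: "real ^ 'n \<Rightarrow> (real ^ 'm) set"
    and f :: "real ^ 'n \<Rightarrow> real ^ 'm \<Rightarrow> real ^ 'l \<Rightarrow> real ^ 'n"
    and r :: "real ^ 'n \<Rightarrow> real ^ 'm \<Rightarrow> real"
    and q :: "real ^ 'n \<Rightarrow> real"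
    and \<xi> :: "'w \<Rightarrow> real ^ 'l"
    and \<xi>seq :: "nat \<Rightarrow> 'w \<Rightarrow> real ^ 'l"
  assumes horizon: "1 \<le> K"
    and borel_sets: "X \<in> sets borel" "U \<in> sets borel" "\<Xi> \<in> sets borel"
    and actions: "\<And>x. x \<in> X \<Longrightarrow> Ua x \<subseteq> U \<and> Ua x \<noteq> {} \<and> Ua x \<in> sets borel"
    and f_maps: "\<And>x u z. \<lbrakk>x \<in> X; u \<in> U; z \<in> \<Xi>\<rbrakk> \<Longrightarrow> f x u z \<in> X"
    and f_meas: "(\<lambda>(x, u, z). f x u z) \<in> borel_measurable (restrict_space borel (X \<times> U \<times> \<Xi>))"
    and r_meas: "(\<lambda>(x, u). r x u) \<in> borel_measurable (restrict_space borel (X \<times> U))"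
    and q_meas: "q \<in> borel_measurable (restrict_space borel X)"
    and \<xi>_rv: "\<xi> \<in> borel_measurable P" "\<And>\<omega>. \<omega> \<in> space P \<Longrightarrow> \<xi> \<omega> \<in> \<Xi>"
    and \<xi>seq_rv: "\<And>t. t < K \<Longrightarrow> \<xi>seq t \<in> borel_measurable P"
      "\<And>t \<omega>. \<lbrakk>t < K; \<omega> \<in> space P\<rbrakk> \<Longrightarrow> \<xi>seq t \<omega> \<in> \<Xi>"
    and \<xi>seq_distr: "\<And>t. t < K \<Longrightarrow> distr P borel (\<xi>seq t) = distr P borel \<xi>"
    and \<xi>seq_indep: "indep_vars (\<lambda>_. borel) \<xi>seq {..<K}"

locale semicontinuous_model = control_problem P K X U \<Xi> Ua f r q \<xi> \<xi>seq
  for P :: "'w measure"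
    and K :: nat
    and X :: "(real ^ 'n) set"
    and U :: "(real ^ 'm) set"
    and \<Xi> :: "(real ^ 'l) set"
    and Ua :: "real ^ 'n \<Rightarrow> (real ^ 'm) set"
    and f :: "real ^ 'n \<Rightarrow> real ^ 'm \<Rightarrow> real ^ 'l \<Rightarrow> real ^ 'n"
    and r :: "real ^ 'n \<Rightarrow> real ^ 'm \<Rightarrow> real"
    and q :: "real ^ 'n \<Rightarrow> real"
    and \<xi> :: "'w \<Rightarrow> real ^ 'l"
    and \<xi>seq :: "nat \<Rightarrow> 'w \<Rightarrow> real ^ 'l" +
  fixes N :: nat
    and \<xi>hat :: "nat \<Rightarrow> real ^ 'l"
    and p :: "nat \<Rightarrow> real"
  assumes A1: "\<And>x. x \<in> X \<Longrightarrow> compact (Ua x)" "usc_multifunction_on X Ua"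
    and A2: "lsc_on (admissible_pairs X Ua) (\<lambda>(x, u). r x u)" "lsc_on X q"
    and A3: "\<exists>rbar qbar \<beta> w. 0 \<le> rbar \<and> 0 \<le> qbar \<and> 1 \<le> \<beta> \<and>
        continuous_on X w \<and> (\<forall>x\<in>X. 1 \<le> w x) \<and>
        (\<forall>(x, u)\<in>admissible_pairs X Ua. \<bar>r x u\<bar> \<le> rbar * w x \<and> \<bar>q x\<bar> \<le> qbar * w x \<and>
           expectation (\<lambda>\<omega>. w (f x u (\<xi> \<omega>))) \<le> \<beta> * w x)"
    and A4: "\<And>z. z \<in> \<Xi> \<Longrightarrow> continuous_on (admissible_pairs X Ua) (\<lambda>(x, u). f x u z)"
    and A5: "\<Xi> = \<xi>hat ` {1..N}"
    and p_def: "\<And>s. s \<in> {1..N} \<Longrightarrow> p s = prob {\<omega> \<in> space P. \<xi> \<omega> = \<xi>hat s}"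
    and p_sum: "(\<Sum>s=1..N. p s) = 1"

definition control_affine ::
    "(real ^ 'n) set \<Rightarrow> (real ^ 'm) set \<Rightarrow> (real ^ 'l) set \<Rightarrow> (real ^ 'n \<Rightarrow> (real ^ 'm) set) \<Rightarrow>
     (real ^ 'n \<Rightarrow> real ^ 'm \<Rightarrow> real ^ 'l \<Rightarrow> real ^ 'n) \<Rightarrow> (real ^ 'n \<Rightarrow> real ^ 'm \<Rightarrow> real) \<Rightarrow>
     (real ^ 'n \<Rightarrow> real ^ 'l \<Rightarrow> real ^ 'n) \<Rightarrow> (real ^ 'n \<Rightarrow> real ^ 'l \<Rightarrow> real ^ 'm ^ 'n) \<Rightarrow> bool" where
  "control_affine X U \<Xi> Ua f r g h \<longleftrightarrow>
     (\<forall>x\<in>X. \<forall>u\<in>U. \<forall>z\<in>\<Xi>. f x u z = g x z + h x z *v u) \<and>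
     (\<lambda>(x, z). g x z) \<in> borel_measurable (restrict_space borel (X \<times> \<Xi>)) \<and>
     (\<lambda>(x, z). h x z) \<in> borel_measurable (restrict_space borel (X \<times> \<Xi>)) \<and>
     (\<forall>z\<in>\<Xi>. continuous_on X (\<lambda>x. g x z) \<and> continuous_on X (\<lambda>x. h x z)) \<and>
     (\<forall>x\<in>X. convex_fun_within (Ua x) (\<lambda>u. r x u))"


section \<open>Discretization\<close>

text \<open>Cells are \<open>C 1, \<dots>, C (NC K)\<close>, nodes are \<open>xn 1, \<dots>, xn (M K)\<close>.\<close>

locale discretization =
  fixes K :: nat
    and X :: "(real ^ 'n) set"
    and \<Xi> :: "(real ^ 'l) set"
    and Ua :: "real ^ 'n \<Rightarrow> (real ^ 'm) set"
    and f :: "real ^ 'n \<Rightarrow> real ^ 'm \<Rightarrow> real ^ 'l \<Rightarrow> real ^ 'n"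
    and Z :: "nat \<Rightarrow> (real ^ 'n) set"
    and C :: "nat \<Rightarrow> (real ^ 'n) set"
    and NC :: "nat \<Rightarrow> nat"
    and xn :: "nat \<Rightarrow> real ^ 'n"
    and M :: "nat \<Rightarrow> nat"
  assumes Z_convex_compact: "\<And>t. t \<le> K \<Longrightarrow> convex (Z t) \<and> compact (Z t)"
    and Z_mono: "\<And>t. t < K \<Longrightarrow> Z t \<subseteq> Z (Suc t)"
    and Z_subset: "Z K \<subseteq> X"
    and Z_step: "\<And>t x u z. \<lbrakk>t < K; x \<in> Z t; u \<in> Ua x; z \<in> \<Xi>\<rbrakk> \<Longrightarrow> f x u z \<in> Z (Suc t)"
    and cells: "\<And>i. i \<in> {1..NC K} \<Longrightarrow> convex (C i) \<and> compact (C i) \<and> C i \<subseteq> Z K"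
    and cells_disjoint:
      "\<And>i j. \<lbrakk>i \<in> {1..NC K}; j \<in> {1..NC K}; i \<noteq> j\<rbrakk> \<Longrightarrow> interior (C i) \<inter> interior (C j) = {}"
    and NC_mono: "\<And>t. t < K \<Longrightarrow> NC t \<le> NC (Suc t)"
    and cells_cover: "\<And>t. t \<le> K \<Longrightarrow> (\<Union>i\<in>{1..NC t}. C i) = Z t"
    and nodes: "\<And>i. i \<in> {1..M K} \<Longrightarrow> xn i \<in> Z K"
    and cells_hull: "\<And>j. j \<in> {1..NC K} \<Longrightarrow> \<exists>I\<subseteq>{1..M K}. C j = convex hull (xn ` I)"
    and M_mono: "\<And>t. t < K \<Longrightarrow> M t \<le> M (Suc t)"
    and nodes_in_Z: "\<And>t. t \<le> K \<Longrightarrow> {i \<in> {1..M K}. xn i \<in> Z t} = {1..M t}"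

definition mesh_size ::
    "nat \<Rightarrow> (nat \<Rightarrow> 'x::real_normed_vector set) \<Rightarrow> (nat \<Rightarrow> nat) \<Rightarrow> (nat \<Rightarrow> 'x) \<Rightarrow> (nat \<Rightarrow> nat) \<Rightarrow> real"
  where
  "mesh_size K C NC xn M =
     Max {norm (xn i - xn j) | k i j. k \<in> {1..NC K} \<and> i \<in> {1..M K} \<and> j \<in> {1..M K} \<and>
                                      xn i \<in> C k \<and> xn j \<in> C k}"


section \<open>Value functions\<close>

text \<open>In the following, infima of real-valued costs are taken with the real \<^const>\<open>Inf\<close>. Under
  \<open>semicontinuous_model\<close> and \<open>discretization\<close> the sets of costs at the relevant states are
  nonempty and bounded below.\<close>

definition dp_operator ::
    "('x \<Rightarrow> 'u set) \<Rightarrow> ('x \<Rightarrow> 'u \<Rightarrow> 'z \<Rightarrow> 'x) \<Rightarrow> ('x \<Rightarrow> 'u \<Rightarrow> real) \<Rightarrow>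
     nat \<Rightarrow> (nat \<Rightarrow> 'z) \<Rightarrow> (nat \<Rightarrow> real) \<Rightarrow> ('x \<Rightarrow> real) \<Rightarrow> 'x \<Rightarrow> real" where
  "dp_operator Ua f r N \<xi>hat p v x =
     (INF u\<in>Ua x. r x u + (\<Sum>s=1..N. p s * v (f x u (\<xi>hat s))))"

function v_opt ::
    "nat \<Rightarrow> ('x \<Rightarrow> 'u set) \<Rightarrow> ('x \<Rightarrow> 'u \<Rightarrow> 'z \<Rightarrow> 'x) \<Rightarrow> ('x \<Rightarrow> 'u \<Rightarrow> real) \<Rightarrow> ('x \<Rightarrow> real) \<Rightarrow>
     nat \<Rightarrow> (nat \<Rightarrow> 'z) \<Rightarrow> (nat \<Rightarrow> real) \<Rightarrow> nat \<Rightarrow> 'x \<Rightarrow> real" where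
  "v_opt K Ua f r q N \<xi>hat p t =
     (if t < K then dp_operator Ua f r N \<xi>hat p (v_opt K Ua f r q N \<xi>hat p (Suc t)) else q)"
  by pat_completeness auto
termination by (relation "Wellfounded.measure (\<lambda>(K, _, _, _, _, _, _, _, t). K - t)") auto

definition prob_vectors :: "nat \<Rightarrow> (nat \<Rightarrow> real) set" where
  "prob_vectors M = {\<gamma>. (\<Sum>i=1..M. \<gamma> i) = 1 \<and> (\<forall>i\<in>{1..M}. 0 \<le> \<gamma> i)}"

text \<open>The pairs \<open>(u, \<gamma>)\<close> over which the approximate operator minimizes; only the entries \<open>\<gamma> s i\<close>
  with \<open>1 \<le> s \<le> N\<close> and \<open>1 \<le> i \<le> M\<close> are relevant.\<close>

definition approx_feasible ::
    "('x::real_vector \<Rightarrow> 'u set) \<Rightarrow> ('x \<Rightarrow> 'u \<Rightarrow> 'z \<Rightarrow> 'x) \<Rightarrow> nat \<Rightarrow> (nat \<Rightarrow> 'z) \<Rightarrow>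
     (nat \<Rightarrow> 'x) \<Rightarrow> nat \<Rightarrow> 'x \<Rightarrow> ('u \<times> (nat \<Rightarrow> nat \<Rightarrow> real)) set" where
  "approx_feasible Ua f N \<xi>hat xn M x =
     {(u, \<gamma>). u \<in> Ua x \<and>
        (\<forall>s\<in>{1..N}. f x u (\<xi>hat s) = (\<Sum>i=1..M. \<gamma> s i *\<^sub>R xn i) \<and> \<gamma> s \<in> prob_vectors M)}"

definition approx_cost ::
    "('x \<Rightarrow> 'u \<Rightarrow> real) \<Rightarrow> nat \<Rightarrow> (nat \<Rightarrow> real) \<Rightarrow> (nat \<Rightarrow> 'x) \<Rightarrow> nat \<Rightarrow>
     ('x \<Rightarrow> real) \<Rightarrow> 'x \<Rightarrow> 'u \<times> (nat \<Rightarrow> nat \<Rightarrow> real) \<Rightarrow> real" where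
  "approx_cost r N p xn M v x = (\<lambda>(u, \<gamma>). r x u + (\<Sum>s=1..N. \<Sum>i=1..M. p s * \<gamma> s i * v (xn i)))"

definition approx_operator ::
    "('x::real_vector \<Rightarrow> 'u set) \<Rightarrow> ('x \<Rightarrow> 'u \<Rightarrow> 'z \<Rightarrow> 'x) \<Rightarrow> ('x \<Rightarrow> 'u \<Rightarrow> real) \<Rightarrow>
     nat \<Rightarrow> (nat \<Rightarrow> 'z) \<Rightarrow> (nat \<Rightarrow> real) \<Rightarrow> (nat \<Rightarrow> 'x) \<Rightarrow> nat \<Rightarrow> ('x \<Rightarrow> real) \<Rightarrow> 'x \<Rightarrow> real" where
  "approx_operator Ua f r N \<xi>hat p xn M v x =
     (INF y\<in>approx_feasible Ua f N \<xi>hat xn M x. approx_cost r N p xn M v x y)"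

function v_hat ::
    "nat \<Rightarrow> ('x::real_vector \<Rightarrow> 'u set) \<Rightarrow> ('x \<Rightarrow> 'u \<Rightarrow> 'z \<Rightarrow> 'x) \<Rightarrow> ('x \<Rightarrow> 'u \<Rightarrow> real) \<Rightarrow> ('x \<Rightarrow> real) \<Rightarrow>
     nat \<Rightarrow> (nat \<Rightarrow> 'z) \<Rightarrow> (nat \<Rightarrow> real) \<Rightarrow> (nat \<Rightarrow> 'x) \<Rightarrow> (nat \<Rightarrow> nat) \<Rightarrow> nat \<Rightarrow> 'x \<Rightarrow> real" where
  "v_hat K Ua f r q N \<xi>hat p xn M t =
     (if t < K
      then approx_operator Ua f r N \<xi>hat p xn (M (Suc t)) (v_hat K Ua f r q N \<xi>hat p xn M (Suc t))
      else q)"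
  by pat_completeness auto
termination by (relation "Wellfounded.measure (\<lambda>(K, _, _, _, _, _, _, _, _, _, t). K - t)") auto

definition approx_policy ::
    "nat \<Rightarrow> ('x::real_vector \<Rightarrow> 'u set) \<Rightarrow> ('x \<Rightarrow> 'u \<Rightarrow> 'z \<Rightarrow> 'x) \<Rightarrow> ('x \<Rightarrow> 'u \<Rightarrow> real) \<Rightarrow> ('x \<Rightarrow> real) \<Rightarrow>
     nat \<Rightarrow> (nat \<Rightarrow> 'z) \<Rightarrow> (nat \<Rightarrow> real) \<Rightarrow> (nat \<Rightarrow> 'x set) \<Rightarrow> (nat \<Rightarrow> 'x) \<Rightarrow> (nat \<Rightarrow> nat) \<Rightarrow>
     (nat \<Rightarrow> 'x \<Rightarrow> 'u) \<Rightarrow> bool" where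
  "approx_policy K Ua f r q N \<xi>hat p Z xn M \<pi>hat \<longleftrightarrow>
     (\<forall>t<K. \<forall>x\<in>Z t. \<exists>\<gamma>.
        is_arg_min
          (approx_cost r N p xn (M (Suc t)) (v_hat K Ua f r q N \<xi>hat p xn M (Suc t)) x)
          (\<lambda>y. y \<in> approx_feasible Ua f N \<xi>hat xn (M (Suc t)) x)
          (\<pi>hat t x, \<gamma>))"

function v_policy ::
    "nat \<Rightarrow> ('x \<Rightarrow> 'u \<Rightarrow> 'z \<Rightarrow> 'x) \<Rightarrow> ('x \<Rightarrow> 'u \<Rightarrow> real) \<Rightarrow> ('x \<Rightarrow> real) \<Rightarrow>
     nat \<Rightarrow> (nat \<Rightarrow> 'z) \<Rightarrow> (nat \<Rightarrow> real) \<Rightarrow> (nat \<Rightarrow> 'x \<Rightarrow> 'u) \<Rightarrow> nat \<Rightarrow> 'x \<Rightarrow> real" where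
  "v_policy K f r q N \<xi>hat p \<pi> t =
     (if t < K
      then (\<lambda>x. r x (\<pi> t x) +
                (\<Sum>s=1..N. p s * v_policy K f r q N \<xi>hat p \<pi> (Suc t) (f x (\<pi> t x) (\<xi>hat s))))
      else q)"
  by pat_completeness auto
termination by (relation "Wellfounded.measure (\<lambda>(K, _, _, _, _, _, _, _, t). K - t)") auto

declare v_opt.simps [simp del] v_hat.simps [simp del] v_policy.simps [simp del]


section \<open>Lipschitz constants over cells\<close>

text \<open>Supremum of a set of nonnegative reals, with value 0 for the empty set.\<close>

definition sup0 :: "real set \<Rightarrow> real" where
  "sup0 A = (if A = {} then 0 else Sup A)"

definition cell_lipschitz ::
    "(nat \<Rightarrow> 'x::real_normed_vector set) \<Rightarrow> nat \<Rightarrow> ('x \<Rightarrow> real) \<Rightarrow> real" where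
  "cell_lipschitz C n v =
     sup0 ((\<lambda>j. sup0 {\<bar>v x - v x'\<bar> / norm (x - x') | x x'. x \<in> C j \<and> x' \<in> C j \<and> x \<noteq> x'}) ` {1..n})"

end

theory Submission
  imports Defs
begin

text \<open>Every reachable successor state lies in a cell, hence is a convex combination of nodes at distance
  at most \<open>\<delta>\<close> from it. Interpolating the optimal value function with these weights costs at most
  \<open>L\<^sub>k \<delta>\<close>, so backward induction bounds the approximate value function from above by the optimal
  one plus the accumulated interpolation errors. Optimality gives the lower bound.\<close>

section \<open>Lipschitz continuity on compact sets and the constants over cells\<close>

text \<open>\<open>local_lipschitz\<close> concerns functions with a time parameter. Giving
  \<open>f\<close> the dummy time set \<open>{0}\<close>, which is compact, reduces the claim to the
  compactness theorem for that notion.\<close>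

lemma locally_lipschitz_on_compact:
  fixes f :: "'a::metric_space \<Rightarrow> 'b::metric_space"
  assumes "compact S" and "locally_lipschitz_on S f"
  shows "\<exists>L. L-lipschitz_on S f"
proof -
  have "local_lipschitz {0::real} S (\<lambda>_. f)"
    using assms(2) unfolding local_lipschitz_def locally_lipschitz_on_def by blast
  then obtain L where "\<And>t. t \<in> {0::real} \<Longrightarrow> L-lipschitz_on S f"
    using local_lipschitz_compact_implies_lipschitz[of "{0::real}" S "\<lambda>_. f"] assms(1)
    by (auto intro: continuous_on_const)
  then show ?thesis by blast
qed

lemma sup0_upper:
  assumes "bdd_above A" and "a \<in> A"
  shows "a \<le> sup0 A"
  using assms by (auto simp: sup0_def intro: cSup_upper)

lemma sup0_nonneg:
  assumes "bdd_above A" and "\<And>a. a \<in> A \<Longrightarrow> 0 \<le> a"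
  shows "0 \<le> sup0 A"
proof (cases "A = {}")
  case False
  then obtain a where "a \<in> A" by blast
  then show ?thesis using sup0_upper[OF assms(1)] assms(2) by force
qed (simp add: sup0_def)

text \<open>A real \<open>Sup\<close> bounds its set only if the set is bounded above. A Lipschitz
  constant \<open>B\<close> on the union of the cells provides this for the difference quotients;
  the size of \<open>B\<close> does not enter the conclusion.\<close>

lemma cell_lipschitz:
  fixes v :: "'a::real_normed_vector \<Rightarrow> real"
  assumes lip: "B-lipschitz_on (\<Union>j\<in>{1..n}. C j) v"
    and j: "j \<in> {1..n}"
  shows "0 \<le> cell_lipschitz C n v"
    and "\<lbrakk>x \<in> C j; y \<in> C j\<rbrakk> \<Longrightarrow> \<bar>v x - v y\<bar> \<le> cell_lipschitz C n v * norm (x - y)"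
proof -
  let ?A = "\<lambda>j. {\<bar>v x - v x'\<bar> / norm (x - x') | x x'. x \<in> C j \<and> x' \<in> C j \<and> x \<noteq> x'}"
  have "\<bar>v x - v x'\<bar> / norm (x - x') \<le> B" if "x \<in> C j" "x' \<in> C j" "x \<noteq> x'" for x x'
  proof -
    have "dist (v x) (v x') \<le> B * dist x x'"
      using that j by (intro lipschitz_onD[OF lip]) auto
    then show ?thesis using that by (simp add: dist_norm divide_le_eq)
  qed
  then have bdd: "bdd_above (?A j)" by (intro bdd_aboveI[of _ B]) blast
  \<comment> \<open>The outer supremum ranges over finitely many cells, so it is bounded without
    further estimates.\<close>
  have le: "sup0 (?A j) \<le> cell_lipschitz C n v"
    unfolding cell_lipschitz_def using j by (intro sup0_upper bdd_above_finite) auto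
  moreover have "0 \<le> sup0 (?A j)" by (rule sup0_nonneg[OF bdd]) auto
  ultimately show "0 \<le> cell_lipschitz C n v" by linarith
  show "\<bar>v x - v y\<bar> \<le> cell_lipschitz C n v * norm (x - y)" if "x \<in> C j" "y \<in> C j"
  proof (cases "x = y")
    case False
    then have "\<bar>v x - v y\<bar> / norm (x - y) \<le> sup0 (?A j)"
      using that by (intro sup0_upper[OF bdd]) auto
    then have "\<bar>v x - v y\<bar> / norm (x - y) \<le> cell_lipschitz C n v" using le by linarith
    then show ?thesis using False by (simp add: divide_le_eq)
  qed simp
qed

section \<open>Interpolation by the nodes of a cell\<close>

text \<open>Convex hulls carry weights on points, whereas weights on indices are wanted and
  \<open>x\<close> may repeat points. The weights are put on a subset \<open>J\<close> of
  \<open>I\<close> on which \<open>x\<close> is injective with the same image, and all other indices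
  get 0.\<close>

lemma convex_hull_image_weights:
  fixes x :: "'i \<Rightarrow> 'a::real_vector"
  assumes I: "finite I" and y: "y \<in> convex hull (x ` I)"
  obtains c where "\<And>i. 0 \<le> c i" "\<And>i. i \<notin> I \<Longrightarrow> c i = 0" "sum c I = 1"
    "(\<Sum>i\<in>I. c i *\<^sub>R x i) = y"
proof -
  obtain J where J: "J \<subseteq> I" "inj_on x J" "x ` I = x ` J"
    using subset_image_inj[of "x ` I" x I] by auto
  obtain w where w: "\<And>z. z \<in> x ` J \<Longrightarrow> 0 \<le> w z" "sum w (x ` J) = 1"
      "(\<Sum>z\<in>x ` J. w z *\<^sub>R z) = y"
    using y I J(1) unfolding J(3) by (auto simp: convex_hull_finite finite_subset)
  define c where "c i = (if i \<in> J then w (x i) else 0)" for i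
  have "sum c I = sum c J" "(\<Sum>i\<in>I. c i *\<^sub>R x i) = (\<Sum>i\<in>J. c i *\<^sub>R x i)"
    using I J(1) by (intro sum.mono_neutral_right; simp add: c_def)+
  moreover have "sum c J = 1" "(\<Sum>i\<in>J. c i *\<^sub>R x i) = y"
    using w(2,3) J(2) by (simp_all add: c_def sum.reindex)
  moreover have "\<And>i. 0 \<le> c i" "\<And>i. i \<notin> I \<Longrightarrow> c i = 0"
    using w(1) J(1) by (auto simp: c_def)
  ultimately show thesis by (intro that) auto
qed

context discretization
begin

lemma Z_subset_final: "t \<le> K \<Longrightarrow> Z t \<subseteq> Z K"
  by (rule inc_induct[where P = "\<lambda>t. Z t \<subseteq> Z K"]) (use Z_mono in blast)+

lemma NC_le_final: "t \<le> K \<Longrightarrow> NC t \<le> NC K"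
  by (rule inc_induct[where P = "\<lambda>t. NC t \<le> NC K"]) (use NC_mono le_trans in blast)+

lemma mesh_size_upper:
  assumes "k \<in> {1..NC K}" "i \<in> {1..M K}" "j \<in> {1..M K}" "xn i \<in> C k" "xn j \<in> C k"
  shows "norm (xn i - xn j) \<le> mesh_size K C NC xn M"
  unfolding mesh_size_def
proof (rule Max_ge)
  \<comment> \<open>\<open>Max\<close> is meaningful only for a finite set. The values depend on the
    pair of node indices alone, not on the cell.\<close>
  have "{norm (xn i - xn j) | k i j. k \<in> {1..NC K} \<and> i \<in> {1..M K} \<and> j \<in> {1..M K} \<and>
      xn i \<in> C k \<and> xn j \<in> C k} \<subseteq> (\<lambda>(i, j). norm (xn i - xn j)) ` ({1..M K} \<times> {1..M K})"
    by auto
  then show "finite {norm (xn i - xn j) | k i j. k \<in> {1..NC K} \<and> i \<in> {1..M K} \<and> j \<in> {1..M K} \<and>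
      xn i \<in> C k \<and> xn j \<in> C k}"
    by (rule finite_subset) simp
qed (use assms in blast)

text \<open>Pick a cell containing \<open>y\<close> and write \<open>y\<close> as a convex
  combination of the nodes spanning it. Each of these nodes is within \<delta> of \<open>y\<close>,
  so its value exceeds \<open>v y\<close> by at most the cell constant times \<delta>, and averaging
  preserves this bound.\<close>

lemma interpolation:
  assumes t: "t \<le> K" and y: "y \<in> Z t" and lip: "locally_lipschitz_on (Z t) v"
  obtains c where "c \<in> prob_vectors (M t)" "(\<Sum>i=1..M t. c i *\<^sub>R xn i) = y"
    "(\<Sum>i=1..M t. c i * v (xn i)) \<le> v y + cell_lipschitz C (NC t) v * mesh_size K C NC xn M"
proof -
  let ?L = "cell_lipschitz C (NC t) v" and ?d = "mesh_size K C NC xn M"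
  obtain j where j: "j \<in> {1..NC t}" "y \<in> C j" using cells_cover[OF t] y by blast
  have jK: "j \<in> {1..NC K}" using j(1) NC_le_final[OF t] by auto
  obtain I where I: "I \<subseteq> {1..M K}" "C j = convex hull (xn ` I)" using cells_hull[OF jK] by blast
  have CZ: "C j \<subseteq> Z t" using cells_cover[OF t] j(1) by blast
  have node: "xn i \<in> C j" if "i \<in> I" for i using that I(2) by (simp add: hull_inc)
  \<comment> \<open>The spanning nodes lie in \<open>Z t\<close> together with their cell, so they
    are among the nodes available at stage \<open>t\<close>.\<close>
  have IM: "I \<subseteq> {1..M t}" using I(1) node CZ nodes_in_Z[OF t] by blast
  \<comment> \<open>The mesh size controls distances between nodes only. A ball around one node
    contains the other nodes of the cell and, being convex, their whole hull, hence
    \<open>y\<close>.\<close>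
  have near: "norm (xn i - y) \<le> ?d" if i: "i \<in> I" for i
  proof -
    have "xn ` I \<subseteq> cball (xn i) ?d"
    proof (rule image_subsetI)
      show "xn k \<in> cball (xn i) ?d" if "k \<in> I" for k
        unfolding mem_cball dist_norm
        using i that I(1) by (intro mesh_size_upper[OF jK] node) auto
    qed
    then have "convex hull (xn ` I) \<subseteq> cball (xn i) ?d" by (intro hull_minimal) auto
    then show ?thesis using j(2) I(2) by (auto simp: dist_norm)
  qed
  obtain B where B: "B-lipschitz_on (\<Union>j\<in>{1..NC t}. C j) v"
    using locally_lipschitz_on_compact[OF _ lip] Z_convex_compact[OF t] cells_cover[OF t] by metis
  have vnode: "v (xn i) \<le> v y + ?L * ?d" if i: "i \<in> I" for i
  proof -
    have "\<bar>v (xn i) - v y\<bar> \<le> ?L * norm (xn i - y)"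
      using cell_lipschitz(2)[OF B j(1)] node[OF i] j(2) by blast
    also have "\<dots> \<le> ?L * ?d"
      using near[OF i] cell_lipschitz(1)[OF B j(1)] by (rule mult_left_mono)
    finally show ?thesis by linarith
  qed
  have "finite I" using I(1) finite_subset by blast
  then obtain c where c: "\<And>i. 0 \<le> c i" "\<And>i. i \<notin> I \<Longrightarrow> c i = 0" "sum c I = 1"
      "(\<Sum>i\<in>I. c i *\<^sub>R xn i) = y"
    using convex_hull_image_weights[of I y xn] j(2) I(2) by blast
  have restr: "(\<Sum>i=1..M t. c i) = sum c I"
      "(\<Sum>i=1..M t. c i *\<^sub>R xn i) = (\<Sum>i\<in>I. c i *\<^sub>R xn i)"
      "(\<Sum>i=1..M t. c i * v (xn i)) = (\<Sum>i\<in>I. c i * v (xn i))"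
    using IM c(2) by (auto intro!: sum.mono_neutral_right)
  have "(\<Sum>i\<in>I. c i * v (xn i)) \<le> (\<Sum>i\<in>I. c i * (v y + ?L * ?d))"
    using vnode c(1) by (intro sum_mono mult_left_mono)
  also have "\<dots> = v y + ?L * ?d" by (simp add: c(3) flip: sum_distrib_right)
  finally show thesis using c restr by (intro that[of c]) (auto simp: prob_vectors_def)
qed

end

section \<open>Backward induction for the two bounds\<close>

text \<open>The minimum value is itself a lower bound. Thus attainment, which is part of the
  definition of the approximate policy, makes the real infimum in the approximate operator well
  behaved.\<close>

lemma is_arg_min_image_bounds:
  fixes F :: "'a \<Rightarrow> real"
  assumes "is_arg_min F (\<lambda>y. y \<in> A) a"
  shows "a \<in> A" and "bdd_below (F ` A)"
  using assms by (auto simp: is_arg_min_linorder intro!: bdd_belowI[of _ "F a"])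

text \<open>The action of the policy is one of the candidates in the infimum, and nonnegative
  \<open>p s\<close> carry the inequality from stage \<open>Suc t\<close> to \<open>t\<close>. The
  boundedness assumptions ensure that the real infimum is a lower bound of the costs.\<close>

lemma v_opt_le_v_policy:
  assumes p: "\<And>s. s \<in> {1..N} \<Longrightarrow> 0 \<le> p s"
    and pol: "\<And>t x. \<lbrakk>t < K; x \<in> Z t\<rbrakk> \<Longrightarrow> \<pi> t x \<in> Ua x"
    and f_Z: "\<And>t x u s. \<lbrakk>t < K; x \<in> Z t; u \<in> Ua x; s \<in> {1..N}\<rbrakk> \<Longrightarrow> f x u (\<xi>hat s) \<in> Z (Suc t)"
    and bdd_r: "\<And>t x. \<lbrakk>t < K; x \<in> Z t\<rbrakk> \<Longrightarrow> bdd_below (r x ` Ua x)"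
    and bdd_v: "\<And>t. t \<le> K \<Longrightarrow> bdd_below (v_opt K Ua f r q N \<xi>hat p t ` Z t)"
    and t: "t \<le> K" and x: "x \<in> Z t"
  shows "v_opt K Ua f r q N \<xi>hat p t x \<le> v_policy K f r q N \<xi>hat p \<pi> t x"
  using t x
proof (induction t arbitrary: x rule: inc_induct)
  case base
  then show ?case by (simp add: v_opt.simps v_policy.simps)
next
  case (step t)
  let ?v = "v_opt K Ua f r q N \<xi>hat p (Suc t)"
  let ?cost = "\<lambda>u. r x u + (\<Sum>s=1..N. p s * ?v (f x u (\<xi>hat s)))"
  obtain a where a: "\<And>u. u \<in> Ua x \<Longrightarrow> a \<le> r x u"
    using bdd_r[OF step.hyps(2) step.prems] by (auto simp: bdd_below_def)
  obtain b where b: "\<And>z. z \<in> Z (Suc t) \<Longrightarrow> b \<le> ?v z"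
    using bdd_v[of "Suc t"] step.hyps(2) by (auto simp: bdd_below_def)
  have "a + (\<Sum>s=1..N. p s * b) \<le> ?cost u" if "u \<in> Ua x" for u
    using that step.hyps step.prems
    by (intro add_mono a sum_mono mult_left_mono b p f_Z[of t])
  then have bdd: "bdd_below (?cost ` Ua x)" by (rule bdd_belowI2)
  \<comment> \<open>The recursion is instantiated at \<open>t\<close> so that the value function at
    \<open>Suc t\<close> stays folded.\<close>
  have "v_opt K Ua f r q N \<xi>hat p t x \<le> ?cost (\<pi> t x)"
    using step.hyps(2) cINF_lower[OF bdd pol[OF step.hyps(2) step.prems]]
    by (simp add: v_opt.simps[of K _ _ _ _ _ _ _ t] dp_operator_def)
  also have "\<dots> \<le> v_policy K f r q N \<xi>hat p \<pi> t x"
    using step.hyps(2) step.prems pol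
    by (subst v_policy.simps) (auto intro!: sum_mono mult_left_mono p step.IH f_Z[of t])
  finally show ?case .
qed

text \<open>Each action \<open>u\<close> extends to a feasible pair \<open>(u, \<gamma>)\<close> by
  choosing interpolation weights for every successor state. Its approximate cost exceeds the exact
  one by at most the interpolation error at stage \<open>Suc t\<close> plus the error inherited from
  later stages.\<close>

lemma (in discretization) v_hat_le_v_opt:
  fixes r q N \<xi>hat p
  defines "v \<equiv> v_opt K Ua f r q N \<xi>hat p" and "vh \<equiv> v_hat K Ua f r q N \<xi>hat p xn M"
  assumes p: "\<And>s. s \<in> {1..N} \<Longrightarrow> 0 \<le> p s" "(\<Sum>s=1..N. p s) = 1"
    and \<xi>hat: "\<And>s. s \<in> {1..N} \<Longrightarrow> \<xi>hat s \<in> \<Xi>"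
    and nonempty: "\<And>x. x \<in> Z K \<Longrightarrow> Ua x \<noteq> {}"
    and bdd: "\<And>t x. \<lbrakk>t < K; x \<in> Z t\<rbrakk> \<Longrightarrow>
      bdd_below (approx_cost r N p xn (M (Suc t)) (vh (Suc t)) x `
        approx_feasible Ua f N \<xi>hat xn (M (Suc t)) x)"
    and lip: "\<And>t. t \<le> K \<Longrightarrow> locally_lipschitz_on (Z t) (v t)"
    and t: "t \<le> K" and x: "x \<in> Z t"
  shows "vh t x \<le> v t x + (\<Sum>k=t+1..K. cell_lipschitz C (NC k) (v k) * mesh_size K C NC xn M)"
  using t x
proof (induction t arbitrary: x rule: inc_induct)
  case base
  then show ?case by (simp add: v_def vh_def v_opt.simps v_hat.simps)
next
  case (step t)
  \<comment> \<open>The sum starts at \<open>t+1\<close> because stage \<open>t\<close> interpolates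
    the value function of the next stage; at \<open>K\<close> both functions equal \<open>q\<close>
    and the sum is empty.\<close>
  define E where "E t = (\<Sum>k=t+1..K. cell_lipschitz C (NC k) (v k) * mesh_size K C NC xn M)" for t
  have Suc_t: "Suc t \<le> K" using step.hyps by simp
  have E: "E t = cell_lipschitz C (NC (Suc t)) (v (Suc t)) * mesh_size K C NC xn M + E (Suc t)"
    using Suc_t by (simp add: E_def sum.atLeast_Suc_atMost)
  have "vh t x - E t \<le> r x u + (\<Sum>s=1..N. p s * v (Suc t) (f x u (\<xi>hat s)))"
    if u: "u \<in> Ua x" for u
  proof -
    have "\<forall>s\<in>{1..N}. \<exists>c. c \<in> prob_vectors (M (Suc t)) \<and>
        (\<Sum>i=1..M (Suc t). c i *\<^sub>R xn i) = f x u (\<xi>hat s) \<and>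
        (\<Sum>i=1..M (Suc t). c i * vh (Suc t) (xn i)) \<le> v (Suc t) (f x u (\<xi>hat s)) + E t"
    proof
      fix s assume s: "s \<in> {1..N}"
      have "f x u (\<xi>hat s) \<in> Z (Suc t)" using Z_step step u \<xi>hat[OF s] by blast
      from interpolation[OF Suc_t this lip[OF Suc_t]]
      obtain c where c: "c \<in> prob_vectors (M (Suc t))"
        "(\<Sum>i=1..M (Suc t). c i *\<^sub>R xn i) = f x u (\<xi>hat s)"
        "(\<Sum>i=1..M (Suc t). c i * v (Suc t) (xn i)) \<le> v (Suc t) (f x u (\<xi>hat s)) +
           cell_lipschitz C (NC (Suc t)) (v (Suc t)) * mesh_size K C NC xn M"
        by blast
      \<comment> \<open>The induction hypothesis is used at nodes only; since the weights sum to 1,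
        the inherited error passes through the average unchanged.\<close>
      have "xn i \<in> Z (Suc t)" if "i \<in> {1..M (Suc t)}" for i
        using that nodes_in_Z[OF Suc_t] by blast
      then have "(\<Sum>i=1..M (Suc t). c i * vh (Suc t) (xn i)) \<le>
          (\<Sum>i=1..M (Suc t). c i * (v (Suc t) (xn i) + E (Suc t)))"
        using c(1) step.IH by (intro sum_mono mult_left_mono) (auto simp: prob_vectors_def E_def)
      also have "\<dots> = (\<Sum>i=1..M (Suc t). c i * v (Suc t) (xn i)) + E (Suc t)"
        using c(1) by (simp add: prob_vectors_def distrib_left sum.distrib flip: sum_distrib_right)
      finally show "\<exists>c. c \<in> prob_vectors (M (Suc t)) \<and>
          (\<Sum>i=1..M (Suc t). c i *\<^sub>R xn i) = f x u (\<xi>hat s) \<and>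
          (\<Sum>i=1..M (Suc t). c i * vh (Suc t) (xn i)) \<le> v (Suc t) (f x u (\<xi>hat s)) + E t"
        using c E by (intro exI[of _ c]) auto
    qed
    from bchoice[OF this] obtain \<gamma> where \<gamma>: "\<And>s. s \<in> {1..N} \<Longrightarrow> \<gamma> s \<in> prob_vectors (M (Suc t))"
      "\<And>s. s \<in> {1..N} \<Longrightarrow> (\<Sum>i=1..M (Suc t). \<gamma> s i *\<^sub>R xn i) = f x u (\<xi>hat s)"
      "\<And>s. s \<in> {1..N} \<Longrightarrow>
        (\<Sum>i=1..M (Suc t). \<gamma> s i * vh (Suc t) (xn i)) \<le> v (Suc t) (f x u (\<xi>hat s)) + E t"
      by blast
    have "(u, \<gamma>) \<in> approx_feasible Ua f N \<xi>hat xn (M (Suc t)) x"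
      using u \<gamma>(1,2) by (auto simp: approx_feasible_def)
    then have "vh t x \<le> approx_cost r N p xn (M (Suc t)) (vh (Suc t)) x (u, \<gamma>)"
      using cINF_lower[OF bdd] step
      by (simp add: vh_def v_hat.simps[of K _ _ _ _ _ _ _ _ _ t] approx_operator_def)
    also have "\<dots> = r x u + (\<Sum>s=1..N. p s * (\<Sum>i=1..M (Suc t). \<gamma> s i * vh (Suc t) (xn i)))"
      by (simp add: approx_cost_def sum_distrib_left mult.assoc)
    \<comment> \<open>The error bound is the same for all scenarios, so averaging over
      \<open>p\<close> leaves a single \<open>E t\<close>.\<close>
    also have "\<dots> \<le> r x u + (\<Sum>s=1..N. p s * (v (Suc t) (f x u (\<xi>hat s)) + E t))"
      using p(1) \<gamma>(3) by (intro add_left_mono sum_mono mult_left_mono)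
    also have "\<dots> = r x u + (\<Sum>s=1..N. p s * v (Suc t) (f x u (\<xi>hat s))) + E t"
      using p(2) by (simp add: distrib_left sum.distrib flip: sum_distrib_right)
    finally show ?thesis by simp
  qed
  moreover have "Ua x \<noteq> {}" using nonempty Z_subset_final[of t] step by auto
  ultimately have "vh t x - E t \<le> v t x"
    using step.hyps(2) unfolding v_def
    by (auto simp: v_opt.simps[of K _ _ _ _ _ _ _ t] dp_operator_def intro!: cINF_greatest)
  then show ?case by (simp add: E_def)
qed

section \<open>Boundedness conditions and conclusion\<close>

theorem proposition5:
  fixes P :: "'w measure"
    and K N :: nat
    and X :: "(real ^ 'n) set"
    and U :: "(real ^ 'm) set"
    and \<Xi> :: "(real ^ 'l) set"
    and Ua :: "real ^ 'n \<Rightarrow> (real ^ 'm) set"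
    and f :: "real ^ 'n \<Rightarrow> real ^ 'm \<Rightarrow> real ^ 'l \<Rightarrow> real ^ 'n"
    and r :: "real ^ 'n \<Rightarrow> real ^ 'm \<Rightarrow> real"
    and q :: "real ^ 'n \<Rightarrow> real"
    and \<xi> :: "'w \<Rightarrow> real ^ 'l"
    and \<xi>seq :: "nat \<Rightarrow> 'w \<Rightarrow> real ^ 'l"
    and \<xi>hat :: "nat \<Rightarrow> real ^ 'l"
    and p :: "nat \<Rightarrow> real"
    and g :: "real ^ 'n \<Rightarrow> real ^ 'l \<Rightarrow> real ^ 'n"
    and h :: "real ^ 'n \<Rightarrow> real ^ 'l \<Rightarrow> real ^ 'm ^ 'n"
    and Z C :: "nat \<Rightarrow> (real ^ 'n) set"
    and NC M :: "nat \<Rightarrow> nat"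
    and xn :: "nat \<Rightarrow> real ^ 'n"
    and \<pi>hat :: "nat \<Rightarrow> real ^ 'n \<Rightarrow> real ^ 'm"
    and vstar vhat vpi :: "nat \<Rightarrow> real ^ 'n \<Rightarrow> real"
    and L :: "nat \<Rightarrow> real"
    and \<delta> :: real
  assumes "semicontinuous_model P K X U \<Xi> Ua f r q \<xi> \<xi>seq N \<xi>hat p"
    and "control_affine X U \<Xi> Ua f r g h"
    and "discretization K X \<Xi> Ua f Z C NC xn M"
    and "approx_policy K Ua f r q N \<xi>hat p Z xn M \<pi>hat"
    and "vstar = v_opt K Ua f r q N \<xi>hat p"
    and "vhat = v_hat K Ua f r q N \<xi>hat p xn M"
    and "vpi = v_policy K f r q N \<xi>hat p \<pi>hat"
    and "L = (\<lambda>k. cell_lipschitz C (NC k) (vstar k))"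
    and "\<delta> = mesh_size K C NC xn M"
    and "\<forall>t\<le>K. locally_lipschitz_on (Z t) (vstar t)"
  shows "\<forall>t\<le>K. \<forall>x\<in>Z t.
           0 \<le> vpi t x - vstar t x \<and>
           vpi t x - vstar t x \<le> vpi t x - vhat t x + (\<Sum>k=t+1..K. L k * \<delta>)"
proof -
  interpret S: semicontinuous_model P K X U \<Xi> Ua f r q \<xi> \<xi>seq N \<xi>hat p by fact
  interpret D: discretization K X \<Xi> Ua f Z C NC xn M by fact
  have p_nonneg: "0 \<le> p s" if "s \<in> {1..N}" for s using S.p_def[OF that] by simp
  have \<xi>hat: "\<xi>hat s \<in> \<Xi>" if "s \<in> {1..N}" for s using that S.A5 by blast
  have ZX: "Z t \<subseteq> X" if "t \<le> K" for t using D.Z_subset_final[OF that] D.Z_subset by blast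
  \<comment> \<open>The growth bound in \<open>A3\<close> depends on the state alone, hence is
    uniform over the actions.\<close>
  have bdd_r: "bdd_below (r x ` Ua x)" if "t < K" "x \<in> Z t" for t x
  proof -
    have "x \<in> X" using ZX[of t] that by auto
    obtain rbar w where "\<forall>(x, u)\<in>admissible_pairs X Ua. \<bar>r x u\<bar> \<le> rbar * w x"
      using S.A3 by fast
    then have "- (rbar * w x) \<le> r x u" if "u \<in> Ua x" for u
      using \<open>x \<in> X\<close> that by (fastforce simp: admissible_pairs_def)
    then show ?thesis by (rule bdd_belowI2)
  qed
  have lip: "locally_lipschitz_on (Z t) (v_opt K Ua f r q N \<xi>hat p t)" if "t \<le> K" for t
    using assms(10) that unfolding assms(5) by blast
  \<comment> \<open>The Lipschitz assumption makes the optimal value function continuous on the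
    compact set \<open>Z t\<close>.\<close>
  have bdd_v: "bdd_below (v_opt K Ua f r q N \<xi>hat p t ` Z t)" if "t \<le> K" for t
  proof -
    have "compact (Z t)" using D.Z_convex_compact[OF that] by blast
    then have "compact (v_opt K Ua f r q N \<xi>hat p t ` Z t)"
      using locally_lipschitz_on_compact[OF _ lip[OF that]] lipschitz_on_continuous_on
        compact_continuous_image by blast
    then show ?thesis by (intro bounded_imp_bdd_below compact_imp_bounded)
  qed
  have pol: "\<exists>\<gamma>. is_arg_min
      (approx_cost r N p xn (M (Suc t)) (v_hat K Ua f r q N \<xi>hat p xn M (Suc t)) x)
      (\<lambda>y. y \<in> approx_feasible Ua f N \<xi>hat xn (M (Suc t)) x) (\<pi>hat t x, \<gamma>)"
    if "t < K" "x \<in> Z t" for t x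
    using assms(4) that unfolding approx_policy_def by blast
  have \<pi>hat: "\<pi>hat t x \<in> Ua x" if "t < K" "x \<in> Z t" for t x
    using pol[OF that] is_arg_min_image_bounds(1) by (fastforce simp: approx_feasible_def)
  have bdd_cost: "bdd_below (approx_cost r N p xn (M (Suc t)) (v_hat K Ua f r q N \<xi>hat p xn M (Suc t)) x `
      approx_feasible Ua f N \<xi>hat xn (M (Suc t)) x)" if "t < K" "x \<in> Z t" for t x
    using pol[OF that] by (elim exE is_arg_min_image_bounds(2))
  have f_Z: "f x u (\<xi>hat s) \<in> Z (Suc t)"
    if "t < K" "x \<in> Z t" "u \<in> Ua x" "s \<in> {1..N}" for t x u s
    using D.Z_step that \<xi>hat by blast
  have Ua: "Ua x \<noteq> {}" if "x \<in> Z K" for x using S.actions that D.Z_subset by blast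
  have "vstar t x \<le> vpi t x" if "t \<le> K" "x \<in> Z t" for t x
    unfolding assms(5,7)
    by (rule v_opt_le_v_policy[where Z = Z and Ua = Ua])
      (fact p_nonneg \<pi>hat f_Z bdd_r bdd_v that)+
  \<comment> \<open>The policy cost cancels from the right-hand inequality of the claim, which
    leaves this comparison.\<close>
  moreover have "vhat t x \<le> vstar t x + (\<Sum>k=t+1..K. L k * \<delta>)" if "t \<le> K" "x \<in> Z t" for t x
    unfolding assms(5,6,8,9)
    by (rule D.v_hat_le_v_opt) (fact p_nonneg S.p_sum \<xi>hat Ua bdd_cost lip that)+
  ultimately show ?thesis by (simp add: algebra_simps)
qed

end
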